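(* Let $\Gamma_A=(A,\alpha)$ and $\Gamma_B=(B,\beta)$ be two non-negative games and let $i\in A$. The partial tensor product restricts to a well-defined map $$(-\otimes_i-):C(\Gamma_A)\times C(\Gamma_B)\longrightarrow C(\Gamma_A\circ_i\Gamma_B)$$ between the cores of the components and the core of the composite. Furthermore: (1) if $\alpha(\{i\})>0$ and $\beta(B)>0$, then this map is injective; (2) if $\alpha(\{i\})=0$, $\beta(\{l\})=0$ for all $l\in B$, and $\beta(B)>0$, then any element $z\in C(\Gamma_A\circ_i\Gamma_B)$ decomposes as $z=x\otimes_iy$ with $x\in C(\Gamma_A)$ and $y\in I(\Gamma_B)$.
   Context: A game is a pair $\Gamma=(N,v)$, $N$ a nonempty finite totally ordered set of players, $v:\mathcal P(N)\to\mathbb R$ with $v(\emptyset)=0$; it is non-negative if $v(S)\ge0$ for all $S\subseteq N$. For $x\in\mathbb R^N$, $x(S)=\sum_{j\in S}x_j$. The preimputations, imputations and core of $\Gamma$ are $$X(\Gamma)=\{x\in\mathbb R^N:x(N)=v(N)\},\quad I(\Gamma)=\{x\in X(\Gamma):x_j\ge v(\{j\})\ \forall j\in N\},$$ $$C(\Gamma)=\{x\in X(\Gamma):x(S)\ge v(S)\ \forall S\subseteq N\}$$ (possibly empty). For games $(A,\alpha)$, $(B,\beta)$ with disjoint player sets and $i\in A$, the game $(A,\alpha)\circ_i(B,\beta)$ has player set $A\diamond_iB=(A\setminus\{i\})\cup B$ and coalition function $$(\alpha\circ_i\beta)(S)=\beta(B)\alpha(S\cap A)+\partial_i\alpha(S\cap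 A)\,\beta(S\cap B),\qquad \partial_i\alpha(T)=\alpha(T\cup\{i\})-\alpha(T\setminus\{i\}).$$ The partial tensor product of $x\in\mathbb R^A$ and $y\in\mathbb R^B$ is the vector $x\otimes_iy\in\mathbb R^{A\diamond_iB}$ with $(x\otimes_iy)_j=\big(\sum_{l\in B}y_l\big)x_j$ for $j\in A\setminus\{i\}$ and $(x\otimes_iy)_j=x_iy_j$ for $j\in B$. *)

theory Defs
  imports Complex_Main "HOL-Library.FuncSet"
begin

text \<open>The total order on the players is given by its graph, a reflexive relation on the player
  set. Only the values of the coalition function on subsets of the player set are meaningful.\<close>

record 'a game =
  players :: "'a set"
  order :: "('a \<times> 'a) set"
  val :: "'a set \<Rightarrow> real"

definition is_game :: "'a game \<Rightarrow> bool" where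
  "is_game \<Gamma> \<longleftrightarrow> finite (players \<Gamma>) \<and> players \<Gamma> \<noteq> {} \<and>
     linear_order_on (players \<Gamma>) (order \<Gamma>) \<and> val \<Gamma> {} = 0"

definition nonneg_game :: "'a game \<Rightarrow> bool" where
  "nonneg_game \<Gamma> \<longleftrightarrow> (\<forall>S\<subseteq>players \<Gamma>. val \<Gamma> S \<ge> 0)"

text \<open>A vector indexed by \<open>N\<close> is a function in \<open>extensional N\<close>, so that two such vectors are
  equal if and only if they agree on \<open>N\<close>.\<close>

definition preimputations :: "'a game \<Rightarrow> ('a \<Rightarrow> real) set" where
  "preimputations \<Gamma> = {x \<in> extensional (players \<Gamma>). sum x (players \<Gamma>) = val \<Gamma> (players \<Gamma>)}"

definition imputations :: "'a game \<Rightarrow> ('a \<Rightarrow> real) set" where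
  "imputations \<Gamma> = {x \<in> preimputations \<Gamma>. \<forall>j\<in>players \<Gamma>. x j \<ge> val \<Gamma> {j}}"

definition core :: "'a game \<Rightarrow> ('a \<Rightarrow> real) set" where
  "core \<Gamma> = {x \<in> preimputations \<Gamma>. \<forall>S\<subseteq>players \<Gamma>. sum x S \<ge> val \<Gamma> S}"

definition comp_players :: "'a set \<Rightarrow> 'a \<Rightarrow> 'a set \<Rightarrow> 'a set" where
  "comp_players A i B = (A - {i}) \<union> B"

text \<open>The block \<open>B\<close>, with its own order, takes the place of \<open>i\<close> in the order of \<open>A\<close>.\<close>

definition comp_order ::
  "'a set \<Rightarrow> ('a \<times> 'a) set \<Rightarrow> 'a \<Rightarrow> 'a set \<Rightarrow> ('a \<times> 'a) set \<Rightarrow> ('a \<times> 'a) set" where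
  "comp_order A r i B s =
     {(j, k). j \<in> comp_players A i B \<and> k \<in> comp_players A i B \<and>
        (if j \<in> B \<and> k \<in> B then (j, k) \<in> s
         else (if j \<in> B then i else j, if k \<in> B then i else k) \<in> r)}"

definition marginal :: "'a \<Rightarrow> ('a set \<Rightarrow> real) \<Rightarrow> 'a set \<Rightarrow> real" where
  "marginal i \<alpha> T = \<alpha> (T \<union> {i}) - \<alpha> (T - {i})"

definition game_comp :: "'a game \<Rightarrow> 'a \<Rightarrow> 'a game \<Rightarrow> 'a game" where
  "game_comp \<Gamma> i \<Delta> =
     \<lparr>players = comp_players (players \<Gamma>) i (players \<Delta>),
      order = comp_order (players \<Gamma>) (order \<Gamma>) i (players \<Delta>) (order \<Delta>),
      val = (\<lambda>S. val \<Delta> (players \<Delta>) * val \<Gamma> (S \<inter> players \<Gamma>)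
                 + marginal i (val \<Gamma>) (S \<inter> players \<Gamma>) * val \<Delta> (S \<inter> players \<Delta>))\<rparr>"

definition partial_tensor ::
  "'a set \<Rightarrow> 'a \<Rightarrow> 'a set \<Rightarrow> ('a \<Rightarrow> real) \<Rightarrow> ('a \<Rightarrow> real) \<Rightarrow> 'a \<Rightarrow> real" where
  "partial_tensor A i B x y =
     (\<lambda>j\<in>comp_players A i B. if j \<in> B then x i * y j else (\<Sum>l\<in>B. y l) * x j)"

lemma is_game_game_comp:
  assumes "is_game \<Gamma>" "is_game \<Delta>" "players \<Gamma> \<inter> players \<Delta> = {}" "i \<in> players \<Gamma>"
  shows "is_game (game_comp \<Gamma> i \<Delta>)"
proof -
  define A r B s where defs: "A = players \<Gamma>" "r = order \<Gamma>" "B = players \<Delta>" "s = order \<Delta>"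
  have lr: "linear_order_on A r" and ls: "linear_order_on B s"
    and disj: "A \<inter> B = {}" and i: "i \<in> A"
    using assms unfolding is_game_def defs by auto
  have r: "\<And>x. x \<in> A \<Longrightarrow> (x, x) \<in> r" "\<And>x y z. (x, y) \<in> r \<Longrightarrow> (y, z) \<in> r \<Longrightarrow> (x, z) \<in> r"
    "\<And>x y. (x, y) \<in> r \<Longrightarrow> (y, x) \<in> r \<Longrightarrow> x = y"
    "\<And>x y. x \<in> A \<Longrightarrow> y \<in> A \<Longrightarrow> (x, y) \<in> r \<or> (y, x) \<in> r"
    using lr unfolding order_on_defs refl_on_def total_on_def trans_def antisym_def by metis+
  have s: "\<And>x. x \<in> B \<Longrightarrow> (x, x) \<in> s" "\<And>x y z. (x, y) \<in> s \<Longrightarrow> (y, z) \<in> s \<Longrightarrow> (x, z) \<in> s"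
    "\<And>x y. (x, y) \<in> s \<Longrightarrow> (y, x) \<in> s \<Longrightarrow> x = y"
    "\<And>x y. x \<in> B \<Longrightarrow> y \<in> B \<Longrightarrow> (x, y) \<in> s \<or> (y, x) \<in> s"
    using ls unfolding order_on_defs refl_on_def total_on_def trans_def antisym_def by metis+
  let ?C = "comp_players A i B" and ?t = "comp_order A r i B s"
  have "?t \<subseteq> ?C \<times> ?C"
    by (auto simp: comp_order_def)
  moreover have "refl_on ?C ?t"
    using r(1) s(1) by (auto simp: refl_on_def comp_order_def comp_players_def)
  moreover have "trans ?t"
  proof (rule transI)
    fix x y z assume "(x, y) \<in> ?t" "(y, z) \<in> ?t"
    then show "(x, z) \<in> ?t"
      using r(2)[of "if x \<in> B then i else x" "if y \<in> B then i else y" "if z \<in> B then i else z"]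
        r(3)[of i y] s(2)[of x y z]
      by (auto simp: comp_order_def comp_players_def split: if_splits)
  qed
  moreover have "antisym ?t"
  proof (rule antisymI)
    fix x y assume "(x, y) \<in> ?t" "(y, x) \<in> ?t"
    then show "x = y"
      using r(3)[of "if x \<in> B then i else x" "if y \<in> B then i else y"] s(3)[of x y]
      by (auto simp: comp_order_def comp_players_def split: if_splits)
  qed
  moreover have "total_on ?C ?t"
    using r(4) s(4) i by (auto simp: total_on_def comp_order_def comp_players_def)
  ultimately have "linear_order_on ?C ?t"
    unfolding order_on_defs by blast
  then show ?thesis
    using assms by (auto simp: is_game_def game_comp_def comp_players_def defs)
qed

end

theory Submission
  imports Defs
begin

text \<open>Split a coalition of the composite as \<open>T \<union> U\<close> with \<open>T \<subseteq> A - {i}\<close> and \<open>U \<subseteq> B\<close>. Its value is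
  the combination \<open>(\<beta>(B) - \<beta>(U)) \<alpha>(T) + \<beta>(U) \<alpha>(T \<union> {i})\<close>
  (lemma \<open>val_game_comp\<close>), while \<open>x \<otimes>\<^sub>i y\<close> gives it \<open>y(B) x(T) + x\<^sub>i y(U)\<close>
  (lemma \<open>sum_partial_tensor\<close>). If both games are non-negative and \<open>x\<close>, \<open>y\<close> are in their cores, then
  \<open>0 \<le> \<beta>(U) \<le> y(U) \<le> y(B) = \<beta>(B)\<close>, so both weights above are non-negative. The core inequalities
  for \<open>T\<close> and \<open>T \<union> {i}\<close> can therefore be added with these weights, and the result is
  \<open>\<beta>(B) x(T) + \<beta>(U) x\<^sub>i\<close>; replacing \<open>\<beta>(U)\<close> by \<open>y(U)\<close> does not decrease it because \<open>x\<^sub>i \<ge> \<alpha>({i}) \<ge> 0\<close>.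

  For injectivity, the entries of \<open>x \<otimes>\<^sub>i y\<close> outside \<open>B\<close> determine \<open>x\<close> outside \<open>i\<close>, efficiency
  determines \<open>x\<^sub>i\<close>, and since \<open>x\<^sub>i \<ge> \<alpha>({i}) > 0\<close> the entries in \<open>B\<close> determine \<open>y\<close>.

  For the decomposition, let the block \<open>B\<close> act as the single player \<open>i\<close>: giving \<open>i\<close> the total
  payoff \<open>z(B)\<close> and dividing everything by \<open>\<beta>(B)\<close> turns \<open>z\<close> into a core element \<open>x\<close> of the outer
  game, because the coalitions with \<open>U = {}\<close> or \<open>U = B\<close> have the values \<open>\<beta>(B) \<alpha>(T)\<close> and
  \<open>\<beta>(B) \<alpha>(T \<union> {i})\<close> (lemma \<open>contract_in_core\<close>). Then \<open>y\<close> must distribute \<open>\<beta>(B)\<close> over \<open>B\<close> in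
  proportion to \<open>z\<close>. If \<open>\<alpha>({i}) = 0\<close>, the inner players have value \<open>0\<close> in the
  composite and hence non-negative payoffs in \<open>z\<close>, so either \<open>x\<^sub>i > 0\<close> and this
  is possible, or \<open>z\<close> vanishes on \<open>B\<close> and any imputation of the
  inner game serves as \<open>y\<close>.\<close>

section \<open>Coalitions of the composite\<close>

lemma players_game_comp:
  "players (game_comp \<Gamma> i \<Delta>) = (players \<Gamma> - {i}) \<union> players \<Delta>"
  by (simp add: game_comp_def comp_players_def)

lemma val_game_comp:
  assumes "players \<Gamma> \<inter> players \<Delta> = {}" and "T \<subseteq> players \<Gamma> - {i}" and "U \<subseteq> players \<Delta>"
  shows "val (game_comp \<Gamma> i \<Delta>) (T \<union> U) =
    (val \<Delta> (players \<Delta>) - val \<Delta> U) * val \<Gamma> T + val \<Delta> U * val \<Gamma> (insert i T)"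
proof -
  have "(T \<union> U) \<inter> players \<Gamma> = T" "(T \<union> U) \<inter> players \<Delta> = U" "T - {i} = T"
    using assms by auto
  then show ?thesis
    by (simp add: game_comp_def marginal_def algebra_simps)
qed

lemma sum_partial_tensor:
  assumes "finite A" "finite B" "A \<inter> B = {}" "T \<subseteq> A - {i}" "U \<subseteq> B"
  shows "sum (partial_tensor A i B x y) (T \<union> U) = sum y B * sum x T + x i * sum y U"
proof -
  have "finite T" "finite U" "T \<inter> U = {}"
    using assms finite_subset[of T A] finite_subset[of U B] by auto
  then have "sum (partial_tensor A i B x y) (T \<union> U)
      = sum (partial_tensor A i B x y) T + sum (partial_tensor A i B x y) U"
    by (rule sum.union_disjoint)
  also have "sum (partial_tensor A i B x y) T = (\<Sum>j\<in>T. sum y B * x j)"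
    using assms by (intro sum.cong) (auto simp: partial_tensor_def comp_players_def)
  also have "sum (partial_tensor A i B x y) U = (\<Sum>j\<in>U. x i * y j)"
    using assms by (intro sum.cong) (auto simp: partial_tensor_def comp_players_def)
  finally show ?thesis
    by (simp add: sum_distrib_left)
qed

section \<open>The tensor product of core elements\<close>

lemma core_component_ge:
  assumes "x \<in> core \<Gamma>" "j \<in> players \<Gamma>"
  shows "val \<Gamma> {j} \<le> x j"
  using assms unfolding core_def by (auto dest: spec[of _ "{j}"])

lemma core_component_nonneg:
  assumes "nonneg_game \<Gamma>" "x \<in> core \<Gamma>" "j \<in> players \<Gamma>"
  shows "0 \<le> x j"
proof -
  have "0 \<le> val \<Gamma> {j}"
    using assms by (simp add: nonneg_game_def)
  then show ?thesis
    using core_component_ge[OF assms(2,3)] by linarith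
qed

lemma core_sum_players:
  "x \<in> core \<Gamma> \<Longrightarrow> sum x (players \<Gamma>) = val \<Gamma> (players \<Gamma>)"
  by (simp add: core_def preimputations_def)

text \<open>A core element of a non-negative game has non-negative payoffs, so a coalition can never be
  worth more than the grand coalition. This is what makes the weights in \<open>val_game_comp\<close>
  non-negative.\<close>
lemma val_le_val_players:
  assumes "is_game \<Gamma>" "nonneg_game \<Gamma>" "x \<in> core \<Gamma>" "U \<subseteq> players \<Gamma>"
  shows "val \<Gamma> U \<le> val \<Gamma> (players \<Gamma>)"
proof -
  have "val \<Gamma> U \<le> sum x U"
    using assms by (simp add: core_def)
  also have "\<dots> \<le> sum x (players \<Gamma>)"
    using assms by (intro sum_mono2) (auto simp: is_game_def core_component_nonneg)
  finally show ?thesis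
    using core_sum_players[OF assms(3)] by simp
qed

lemma partial_tensor_in_core:
  assumes \<Gamma>: "is_game \<Gamma>" "nonneg_game \<Gamma>" and \<Delta>: "is_game \<Delta>" "nonneg_game \<Delta>"
    and disj: "players \<Gamma> \<inter> players \<Delta> = {}" and i: "i \<in> players \<Gamma>"
    and x: "x \<in> core \<Gamma>" and y: "y \<in> core \<Delta>"
  shows "partial_tensor (players \<Gamma>) i (players \<Delta>) x y \<in> core (game_comp \<Gamma> i \<Delta>)"
proof -
  let ?A = "players \<Gamma>" and ?B = "players \<Delta>"
  let ?z = "partial_tensor ?A i ?B x y"
  have fin: "finite ?A" "finite ?B"
    using \<Gamma> \<Delta> by (auto simp: is_game_def)
  note yB = core_sum_players[OF y]
  have sum_insert_i: "sum x (insert i T) = sum x T + x i" if "T \<subseteq> ?A - {i}" for T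
  proof -
    have "finite T" "i \<notin> T"
      using that fin finite_subset by auto
    then show ?thesis by simp
  qed
  have sum_z: "sum ?z (T \<union> U) = val \<Delta> ?B * sum x T + x i * sum y U"
    if "T \<subseteq> ?A - {i}" "U \<subseteq> ?B" for T U
    using sum_partial_tensor[OF fin disj that] yB by simp
  have ge: "val (game_comp \<Gamma> i \<Delta>) (T \<union> U) \<le> sum ?z (T \<union> U)"
    if T: "T \<subseteq> ?A - {i}" and U: "U \<subseteq> ?B" for T U
  proof -
    have "val \<Gamma> S \<le> sum x S" if "S \<subseteq> ?A" for S
      using x that by (simp add: core_def)
    from this[of T] this[of "insert i T"]
    have xT: "val \<Gamma> T \<le> sum x T" and xTi: "val \<Gamma> (insert i T) \<le> sum x T + x i"
      using T i sum_insert_i[OF T] by auto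
    have yU: "val \<Delta> U \<le> sum y U" and U0: "0 \<le> val \<Delta> U"
      using y \<Delta>(2) U by (auto simp: core_def nonneg_game_def)
    have UB: "val \<Delta> U \<le> val \<Delta> ?B"
      using val_le_val_players[OF \<Delta> y U] .
    have "val (game_comp \<Gamma> i \<Delta>) (T \<union> U)
        = (val \<Delta> ?B - val \<Delta> U) * val \<Gamma> T + val \<Delta> U * val \<Gamma> (insert i T)"
      using val_game_comp[OF disj T U] .
    also have "\<dots> \<le> (val \<Delta> ?B - val \<Delta> U) * sum x T + val \<Delta> U * (sum x T + x i)"
      using xT xTi U0 UB by (intro add_mono mult_left_mono) auto
    also have "\<dots> = val \<Delta> ?B * sum x T + x i * val \<Delta> U"
      by (simp add: algebra_simps)
    also have "\<dots> \<le> val \<Delta> ?B * sum x T + x i * sum y U"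
      using yU core_component_nonneg[OF \<Gamma>(2) x i] by (simp add: mult_left_mono)
    finally show ?thesis
      using sum_z[OF T U] by simp
  qed
  have "sum ?z (players (game_comp \<Gamma> i \<Delta>)) = val \<Delta> ?B * sum x (?A - {i}) + x i * val \<Delta> ?B"
    using sum_z[of "?A - {i}" ?B] yB by (simp add: players_game_comp)
  also have "\<dots> = val \<Delta> ?B * val \<Gamma> ?A"
    using sum_insert_i[of "?A - {i}"] core_sum_players[OF x] i
    by (simp add: insert_absorb algebra_simps)
  also have "\<dots> = val (game_comp \<Gamma> i \<Delta>) (players (game_comp \<Gamma> i \<Delta>))"
    using val_game_comp[OF disj, of "?A - {i}" i ?B] i by (simp add: players_game_comp insert_absorb)
  finally have eff: "sum ?z (players (game_comp \<Gamma> i \<Delta>))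
      = val (game_comp \<Gamma> i \<Delta>) (players (game_comp \<Gamma> i \<Delta>))" .
  have "val (game_comp \<Gamma> i \<Delta>) S \<le> sum ?z S" if "S \<subseteq> players (game_comp \<Gamma> i \<Delta>)" for S
  proof -
    have "S = (S - ?B) \<union> (S \<inter> ?B)" "S - ?B \<subseteq> ?A - {i}"
      using that by (auto simp: players_game_comp)
    then show ?thesis
      using ge[of "S - ?B" "S \<inter> ?B"] by simp
  qed
  moreover have "?z \<in> extensional (players (game_comp \<Gamma> i \<Delta>))"
    by (simp add: partial_tensor_def game_comp_def)
  ultimately show ?thesis
    using eff by (simp add: core_def preimputations_def)
qed

lemma partial_tensor_inj_on_cores:
  assumes \<Gamma>: "is_game \<Gamma>" and disj: "players \<Gamma> \<inter> players \<Delta> = {}" and i: "i \<in> players \<Gamma>"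
    and pos: "0 < val \<Gamma> {i}" "0 < val \<Delta> (players \<Delta>)"
  shows "inj_on (\<lambda>(x, y). partial_tensor (players \<Gamma>) i (players \<Delta>) x y) (core \<Gamma> \<times> core \<Delta>)"
proof (rule inj_onI, clarify)
  let ?A = "players \<Gamma>" and ?B = "players \<Delta>"
  fix x y x' y'
  assume core: "x \<in> core \<Gamma>" "y \<in> core \<Delta>" "x' \<in> core \<Gamma>" "y' \<in> core \<Delta>"
    and eq: "partial_tensor ?A i ?B x y = partial_tensor ?A i ?B x' y'"
  have off_i: "x j = x' j" if "j \<in> ?A - {i}" for j
  proof -
    have "j \<in> comp_players ?A i ?B" "j \<notin> ?B"
      using that disj by (auto simp: comp_players_def)
    then have "sum y ?B * x j = sum y' ?B * x' j"
      using fun_cong[OF eq, of j] by (simp add: partial_tensor_def)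
    then show ?thesis
      using core_sum_players[OF core(2)] core_sum_players[OF core(4)] pos(2) by simp
  qed
  have "finite ?A"
    using \<Gamma> by (simp add: is_game_def)
  then have "x i + sum x (?A - {i}) = x' i + sum x' (?A - {i})"
    using core_sum_players[OF core(1)] core_sum_players[OF core(3)] i
    by (simp flip: sum.remove)
  moreover have "sum x (?A - {i}) = sum x' (?A - {i})"
    using off_i by (intro sum.cong) auto
  ultimately have at_i: "x i = x' i"
    by simp
  have "y l = y' l" if "l \<in> ?B" for l
  proof -
    have "x i * y l = x' i * y' l"
      using fun_cong[OF eq, of l] that by (simp add: partial_tensor_def comp_players_def)
    moreover have "0 < x i"
      using core_component_ge[OF core(1) i] pos(1) by linarith
    ultimately show ?thesis
      using at_i by simp
  qed
  moreover have "x j = x' j" if "j \<in> ?A" for j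
    using that off_i at_i by (cases "j = i") auto
  moreover have "x \<in> extensional ?A" "x' \<in> extensional ?A" "y \<in> extensional ?B" "y' \<in> extensional ?B"
    using core by (auto simp: core_def preimputations_def)
  ultimately show "x = x' \<and> y = y'"
    by (metis extensionalityI)
qed

section \<open>Decomposing core elements of the composite\<close>

text \<open>The scaling by \<open>c\<close> undoes the factor \<open>y(B)\<close> in \<open>x \<otimes>\<^sub>i y\<close>, so that contracting \<open>x \<otimes>\<^sub>i y\<close> with
  \<open>c = y(B) \<noteq> 0\<close> gives back \<open>x\<close>.\<close>
definition contract :: "'a set \<Rightarrow> 'a \<Rightarrow> 'a set \<Rightarrow> real \<Rightarrow> ('a \<Rightarrow> real) \<Rightarrow> 'a \<Rightarrow> real" where
  "contract A i B c z = (\<lambda>j\<in>A. (if j = i then sum z B else z j) / c)"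

lemma sum_contract:
  assumes "finite A" "T \<subseteq> A - {i}"
  shows "sum (contract A i B c z) T = sum z T / c"
proof -
  have "sum (contract A i B c z) T = (\<Sum>j\<in>T. z j / c)"
    using assms by (intro sum.cong) (auto simp: contract_def)
  then show ?thesis
    by (simp add: sum_divide_distrib)
qed

lemma sum_contract_insert:
  assumes "finite A" "finite B" "A \<inter> B = {}" "i \<in> A" "T \<subseteq> A - {i}"
  shows "sum (contract A i B c z) (insert i T) = sum z (T \<union> B) / c"
proof -
  have "finite T" "i \<notin> T" "T \<inter> B = {}"
    using assms finite_subset[of T A] by auto
  moreover have "contract A i B c z i = sum z B / c"
    using assms by (simp add: contract_def)
  ultimately show ?thesis
    using sum_contract[OF assms(1,5)] assms(2)
    by (simp add: sum.union_disjoint add_divide_distrib)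
qed

text \<open>The core inequalities of the outer game are those of the composite for the coalitions that
  contain either none or all of the inner players, divided by \<open>\<beta>(B)\<close>.\<close>
lemma contract_in_core:
  assumes \<Gamma>: "is_game \<Gamma>" and \<Delta>: "is_game \<Delta>"
    and disj: "players \<Gamma> \<inter> players \<Delta> = {}" and i: "i \<in> players \<Gamma>"
    and pos: "0 < val \<Delta> (players \<Delta>)"
    and z: "z \<in> core (game_comp \<Gamma> i \<Delta>)"
  shows "contract (players \<Gamma>) i (players \<Delta>) (val \<Delta> (players \<Delta>)) z \<in> core \<Gamma>"
proof -
  let ?A = "players \<Gamma>" and ?B = "players \<Delta>"
  let ?x = "contract ?A i ?B (val \<Delta> ?B) z"
  have fin: "finite ?A" "finite ?B" and empty: "val \<Delta> {} = 0"
    using \<Gamma> \<Delta> by (auto simp: is_game_def)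
  have z_ge: "val (game_comp \<Gamma> i \<Delta>) (T \<union> U) \<le> sum z (T \<union> U)"
    if "T \<subseteq> ?A - {i}" "U \<subseteq> ?B" for T U
  proof -
    have "T \<union> U \<subseteq> players (game_comp \<Gamma> i \<Delta>)"
      using that by (auto simp: players_game_comp)
    then show ?thesis
      using z by (simp add: core_def)
  qed
  have "val \<Gamma> T \<le> sum ?x T" if "T \<subseteq> ?A" for T
  proof (cases "i \<in> T")
    case True
    define T' where "T' = T - {i}"
    have T': "T = insert i T'" "T' \<subseteq> ?A - {i}"
      using True that by (auto simp: T'_def)
    have "val \<Delta> ?B * val \<Gamma> T \<le> sum z (T' \<union> ?B)"
      using z_ge[OF T'(2), of ?B] val_game_comp[OF disj T'(2), of ?B] T'(1) by simp
    then show ?thesis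
      using sum_contract_insert[OF fin disj i T'(2)] pos T'(1)
      by (simp add: pos_le_divide_eq mult.commute)
  next
    case False
    then have T: "T \<subseteq> ?A - {i}"
      using that by auto
    have "val \<Delta> ?B * val \<Gamma> T \<le> sum z T"
      using z_ge[OF T, of "{}"] val_game_comp[OF disj T, of "{}"] empty by simp
    then show ?thesis
      using sum_contract[OF fin(1) T] pos by (simp add: pos_le_divide_eq mult.commute)
  qed
  moreover have "sum ?x ?A = val \<Gamma> ?A"
  proof -
    have "sum ?x ?A = sum z (?A - {i} \<union> ?B) / val \<Delta> ?B"
      using sum_contract_insert[OF fin disj i, of "?A - {i}"] i by (simp add: insert_absorb)
    also have "sum z (?A - {i} \<union> ?B) = val (game_comp \<Gamma> i \<Delta>) (?A - {i} \<union> ?B)"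
      using core_sum_players[OF z] by (simp add: players_game_comp)
    also have "\<dots> = val \<Delta> ?B * val \<Gamma> ?A"
      using val_game_comp[OF disj, of "?A - {i}" i ?B] i by (simp add: insert_absorb)
    finally show ?thesis
      using pos by simp
  qed
  ultimately show ?thesis
    by (simp add: core_def preimputations_def contract_def)
qed

lemma core_game_comp_inner_nonneg:
  assumes \<Gamma>: "is_game \<Gamma>" and disj: "players \<Gamma> \<inter> players \<Delta> = {}"
    and zero: "val \<Gamma> {i} = 0" and z: "z \<in> core (game_comp \<Gamma> i \<Delta>)" and l: "l \<in> players \<Delta>"
  shows "0 \<le> z l"
proof -
  have "val (game_comp \<Gamma> i \<Delta>) {l} = 0"
    using val_game_comp[OF disj, of "{}" i "{l}"] l zero \<Gamma> by (simp add: is_game_def)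
  then show ?thesis
    using core_component_ge[OF z, of l] l by (simp add: players_game_comp)
qed

lemma core_game_comp_decomposition:
  assumes \<Gamma>: "is_game \<Gamma>" and \<Delta>: "is_game \<Delta>"
    and disj: "players \<Gamma> \<inter> players \<Delta> = {}" and i: "i \<in> players \<Gamma>"
    and zero: "val \<Gamma> {i} = 0" "\<And>l. l \<in> players \<Delta> \<Longrightarrow> val \<Delta> {l} = 0"
    and pos: "0 < val \<Delta> (players \<Delta>)"
    and z: "z \<in> core (game_comp \<Gamma> i \<Delta>)"
  shows "\<exists>x\<in>core \<Gamma>. \<exists>y\<in>imputations \<Delta>. z = partial_tensor (players \<Gamma>) i (players \<Delta>) x y"
proof -
  let ?A = "players \<Gamma>" and ?B = "players \<Delta>"
  define x where "x = contract ?A i ?B (val \<Delta> ?B) z"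
  have fin: "finite ?B" and nonempty: "?B \<noteq> {}"
    using \<Delta> by (auto simp: is_game_def)
  have z_nonneg: "0 \<le> z l" if "l \<in> ?B" for l
    using core_game_comp_inner_nonneg[OF \<Gamma> disj zero(1) z that] .
  have x_off: "z j = val \<Delta> ?B * x j" if "j \<in> ?A - {i}" for j
    using that pos by (auto simp: x_def contract_def)
  have x_i: "x i = sum z ?B / val \<Delta> ?B"
    using i by (simp add: x_def contract_def)
  obtain w where w: "sum w ?B = val \<Delta> ?B" "\<And>l. l \<in> ?B \<Longrightarrow> 0 \<le> w l" "\<And>l. l \<in> ?B \<Longrightarrow> z l = x i * w l"
  proof (cases "sum z ?B = 0")
    case True
    have z0: "z l = 0" if "l \<in> ?B" for l
      using True sum_nonneg_eq_0_iff[of ?B z] fin z_nonneg that by blast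
    \<comment> \<open>The values of \<open>w\<close> are now multiplied by \<open>x i = 0\<close>, so the equal split will do.\<close>
    show ?thesis
    proof (rule that[of "\<lambda>l. val \<Delta> ?B / card ?B"])
      show "(\<Sum>l\<in>?B. val \<Delta> ?B / card ?B) = val \<Delta> ?B"
        using fin nonempty by simp
      show "0 \<le> val \<Delta> ?B / card ?B"
        using pos by simp
      show "z l = x i * (val \<Delta> ?B / card ?B)" if "l \<in> ?B" for l
        using z0[OF that] x_i True by simp
    qed
  next
    case False
    then have "0 < x i"
      using x_i pos sum_nonneg[of ?B z] z_nonneg by (simp add: less_le)
    moreover have "(\<Sum>l\<in>?B. z l / x i) = val \<Delta> ?B"
    proof -
      have "(\<Sum>l\<in>?B. z l / x i) = sum z ?B / x i"
        by (rule sum_divide_distrib[symmetric])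
      then show ?thesis
        using x_i False pos by simp
    qed
    ultimately show ?thesis
      using that[of "\<lambda>l. z l / x i"] z_nonneg by simp
  qed
  define y where "y = restrict w ?B"
  have sum_y: "sum y ?B = val \<Delta> ?B"
    using w(1) by (simp add: y_def)
  have "y \<in> imputations \<Delta>"
    using sum_y w(2) zero(2) by (simp add: imputations_def preimputations_def y_def)
  moreover have "z = partial_tensor ?A i ?B x y"
  proof (rule extensionalityI[of _ "comp_players ?A i ?B"])
    show "z \<in> extensional (comp_players ?A i ?B)"
      using z by (simp add: core_def preimputations_def game_comp_def)
    show "partial_tensor ?A i ?B x y \<in> extensional (comp_players ?A i ?B)"
      by (simp add: partial_tensor_def)
    show "z j = partial_tensor ?A i ?B x y j" if "j \<in> comp_players ?A i ?B" for j
      using that w(3) x_off sum_y by (auto simp: partial_tensor_def comp_players_def y_def)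
  qed
  moreover have "x \<in> core \<Gamma>"
    unfolding x_def using contract_in_core[OF \<Gamma> \<Delta> disj i pos z] .
  ultimately show ?thesis
    by blast
qed

section \<open>Cores of composites\<close>

theorem theorem4:
  fixes \<Gamma> \<Delta> :: "'a game" and i :: 'a
  assumes "is_game \<Gamma>" and "nonneg_game \<Gamma>"
    and "is_game \<Delta>" and "nonneg_game \<Delta>"
    and "players \<Gamma> \<inter> players \<Delta> = {}"
    and "i \<in> players \<Gamma>"
  shows "(\<lambda>(x, y). partial_tensor (players \<Gamma>) i (players \<Delta>) x y) \<in> core \<Gamma> \<times> core \<Delta> \<rightarrow> core (game_comp \<Gamma> i \<Delta>)
    \<and> (val \<Gamma> {i} > 0 \<and> val \<Delta> (players \<Delta>) > 0 \<longrightarrow>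
         inj_on (\<lambda>(x, y). partial_tensor (players \<Gamma>) i (players \<Delta>) x y) (core \<Gamma> \<times> core \<Delta>))
    \<and> (val \<Gamma> {i} = 0 \<and> (\<forall>l\<in>players \<Delta>. val \<Delta> {l} = 0) \<and> val \<Delta> (players \<Delta>) > 0 \<longrightarrow>
         (\<forall>z\<in>core (game_comp \<Gamma> i \<Delta>). \<exists>x\<in>core \<Gamma>. \<exists>y\<in>imputations \<Delta>. z = partial_tensor (players \<Gamma>) i (players \<Delta>) x y))"
  using partial_tensor_in_core[OF assms] partial_tensor_inj_on_cores[OF assms(1,5,6)]
    core_game_comp_decomposition[OF assms(1,3,5,6)]
  by auto

end
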